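(* Let $B$ be a locally connected metric space and let $X$ be a metric space that is locally compact and locally connected. Let $V$ be a metric space and let $f_t\colon V\to X$ ($t\in B$) be a continuous family of open Lipschitz embeddings. Let $C$ be a closed subset of $V$ whose boundary in $V$ is compact, and assume that $f_t(C)$ is closed in $X$ for all $t\in B$. If $\mathcal{L}(V-C)$ holds, then for each $b\in B$ there exist a neighborhood $N_b$ of $b$ in $B$ and a family of Lipschitz isomorphisms $F_t\colon X\to X$ ($t\in N_b$) such that, for every $t\in N_b$, $F_t\circ f_b=f_t$ near $C$ (that is, on a neighborhood of $C$ in $V$). Further, if $C$ is compact, then one can take the $F_t$ so that, in addition, $F_t\circ f_b=f_b$ away from a compact neighborhood of $C$ (that is, on the complement in $V$ of a compact neighborhood of $C$).
   Context: Lipschitz is a local condition: a map $f\colon X\to Y$ of metric spaces is Lipschitz if every $x\in X$ has an open neighborhood $U$ and a constant $L_x$ with $d_Y(f(x'),f(x''))\le L_x d_X(x',x'')$ for all $x',x''\in U$. It is a Lipschitz embedding if it is injective and both $f\colon X\to f(X)$ and $f^{-1}\colon f(X)\to X$ are Lipschitz; a Lipschitz isomorphism is a bijective Lipschitz embedding. An open Lipschitz embedding is a Lipschitz embedding that is an open map. A family $f_t$ ($t\in B$) is continuous if $(t,x)\mapsto f_t(x)$ is continuous. For a metric space $Y$ (a subset carries the restricted metric), $\mathcal{L}(Y)$ is the statement: for every open $U\subseteq Y$ and every compact $D\subseteq U$, $\mathcal{L}(Y;D;U)$ holds. Here $\mathcal{L}(Y;D;U)$ means: for every open Lipschitz embedding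 $h\colon U\to Y$ sufficiently near the inclusion $i\colon U\to Y$ (i.e. in some neighborhood of $i$ in the compact-open topology) there is a Lipschitz isomorphism $h'\colon Y\to Y$ with $h'=h$ on $D$ and $h'$ equal to the identity on $Y-U$; further the rule $h\mapsto h'$ is canonical, i.e. $h'$ depends continuously on $h$ (compact-open topologies) for $h$ sufficiently near $i$, and the rule sends $i$ to $\mathrm{id}_Y$. *)

theory Defs
  imports "HOL-Analysis.Analysis"
begin

text \<open>Throughout, metric spaces other than whole types are sets carrying the restricted metric.
  Lipschitz is the local condition; on noncompact sets it is weaker than
  \<^const>\<open>lipschitz_on\<close> with one global constant.\<close>

definition locally_lipschitz_on ::
    "'a::metric_space set \<Rightarrow> ('a \<Rightarrow> 'b::metric_space) \<Rightarrow> bool" where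
  "locally_lipschitz_on X f \<longleftrightarrow>
     (\<forall>x\<in>X. \<exists>U L. openin (top_of_set X) U \<and> x \<in> U \<and> L-lipschitz_on U f)"

definition lipschitz_embedding ::
    "'a::metric_space set \<Rightarrow> 'b::metric_space set \<Rightarrow> ('a \<Rightarrow> 'b) \<Rightarrow> bool" where
  "lipschitz_embedding X Y f \<longleftrightarrow>
     f ` X \<subseteq> Y \<and> inj_on f X \<and>
     locally_lipschitz_on X f \<and> locally_lipschitz_on (f ` X) (inv_into X f)"

definition open_lipschitz_embedding ::
    "'a::metric_space set \<Rightarrow> 'b::metric_space set \<Rightarrow> ('a \<Rightarrow> 'b) \<Rightarrow> bool" where
  "open_lipschitz_embedding X Y f \<longleftrightarrow>
     lipschitz_embedding X Y f \<and> open_map (top_of_set X) (top_of_set Y) f"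

definition lipschitz_isomorphism ::
    "'a::metric_space set \<Rightarrow> 'b::metric_space set \<Rightarrow> ('a \<Rightarrow> 'b) \<Rightarrow> bool" where
  "lipschitz_isomorphism X Y f \<longleftrightarrow> lipschitz_embedding X Y f \<and> bij_betw f X Y"

text \<open>The compact-open topology on the set of continuous maps from \<open>X\<close> to \<open>Y\<close>. A map is
  represented by its extensional version, so that its values outside \<open>X\<close> carry no information.
  Taking \<open>K = {}\<close> shows that the underlying set consists of all continuous maps.\<close>

definition compact_open_topology ::
    "'a topology \<Rightarrow> 'b topology \<Rightarrow> ('a \<Rightarrow> 'b) topology" where
  "compact_open_topology X Y =
     topology_generated_by
       {{f \<in> extensional (topspace X). continuous_map X Y f \<and> f ` K \<subseteq> W} | K W.
          compactin X K \<and> openin Y W}"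

lemma topspace_compact_open_topology:
  "topspace (compact_open_topology X Y) =
     {f \<in> extensional (topspace X). continuous_map X Y f}"
proof -
  have "{f \<in> extensional (topspace X). continuous_map X Y f} \<in>
     {{f \<in> extensional (topspace X). continuous_map X Y f \<and> f ` K \<subseteq> W} | K W.
          compactin X K \<and> openin Y W}"
    by (rule CollectI, rule exI[of _ "{}"], rule exI[of _ "{}"]) simp
  then show ?thesis
    unfolding compact_open_topology_def topology_generated_by_topspace by blast
qed

text \<open>\<open>lipschitz_deformation Y D U\<close> is the property written \<open>\<L>(Y;D;U)\<close>, and
  \<open>lipschitz_deformable Y\<close> is \<open>\<L>(Y)\<close>. The neighbourhood \<open>N\<close> of the inclusion
  \<open>restrict id U\<close> makes precise both uses of "sufficiently near" (shrink to the smaller of the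
  two neighbourhoods), and \<open>\<Phi>\<close> is the rule that sends \<open>h\<close> to \<open>h'\<close>.\<close>

definition lipschitz_deformation ::
    "'a::metric_space set \<Rightarrow> 'a set \<Rightarrow> 'a set \<Rightarrow> bool" where
  "lipschitz_deformation Y D U \<longleftrightarrow>
     (\<exists>N \<Phi>.
        openin (compact_open_topology (top_of_set U) (top_of_set Y)) N \<and>
        restrict id U \<in> N \<and>
        (\<forall>h\<in>N. open_lipschitz_embedding U Y h \<longrightarrow>
           lipschitz_isomorphism Y Y (\<Phi> h) \<and>
           (\<forall>x\<in>D. \<Phi> h x = h x) \<and>
           (\<forall>x\<in>Y - U. \<Phi> h x = x)) \<and>
        continuous_map
          (subtopology (compact_open_topology (top_of_set U) (top_of_set Y))
             {h \<in> N. open_lipschitz_embedding U Y h})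
          (compact_open_topology (top_of_set Y) (top_of_set Y)) \<Phi> \<and>
        \<Phi> (restrict id U) = restrict id Y)"

definition lipschitz_deformable :: "'a::metric_space set \<Rightarrow> bool" where
  "lipschitz_deformable Y \<longleftrightarrow>
     (\<forall>U D. openin (top_of_set Y) U \<and> compact D \<and> D \<subseteq> U \<longrightarrow>
        lipschitz_deformation Y D U)"

end

theory Submission
  imports Defs
begin

text \<open>Write \<open>g = f b\<close>. Let \<open>P\<close> be the union of \<open>C\<close> with a compact neighbourhood of its frontier,
  so that the frontier of \<open>P\<close> is compact and disjoint from \<open>C\<close>. Near that frontier
  \<open>h t = g\<inverse> \<circ> f t\<close> is an open Lipschitz embedding into \<open>V - C\<close>, close to the inclusion for \<open>t\<close> near
  \<open>b\<close>, so \<open>\<L>(V - C)\<close> extends it to a Lipschitz isomorphism \<open>G t\<close> of \<open>V\<close> that is the identity off a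
  compact subset of \<open>V - C\<close>. Then \<open>F t\<close> is \<open>f t \<circ> g\<inverse>\<close> on \<open>g(P)\<close>, \<open>g \<circ> G t \<circ> g\<inverse>\<close> on the rest of
  \<open>g(V)\<close>, and the identity elsewhere. These pieces fit together bijectively because
  \<open>f t(P) = g(G t(P))\<close>: the two sets are closed and agree near their common frontier, so their
  differences are open and closed in \<open>X\<close>; for \<open>t\<close> in a connected neighbourhood of \<open>b\<close> the points
  \<open>f t x\<close> and \<open>g(G t x)\<close> lie in one connected set through \<open>g x\<close>, so the differences are empty.\<close>

subsection \<open>Locally bi-Lipschitz open maps\<close>

text \<open>One constant bounds the map and its inverse, and open sets are absolute, since every
  domain that occurs is open in its type. The clause \<open>0 \<le> L\<close> does not follow from
  the estimates when \<open>U\<close> has at most one point; \<open>lipschitz_on\<close> and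
  monotonicity of products ask for it.\<close>

definition bilipschitz_chart ::
    "('a::metric_space \<Rightarrow> 'b::metric_space) \<Rightarrow> 'a set \<Rightarrow> real \<Rightarrow> bool" where
  "bilipschitz_chart f U L \<longleftrightarrow>
     open U \<and> 0 \<le> L \<and>
     (\<forall>u\<in>U. \<forall>v\<in>U. dist (f u) (f v) \<le> L * dist u v \<and> dist u v \<le> L * dist (f u) (f v)) \<and>
     (\<forall>T. open T \<and> T \<subseteq> U \<longrightarrow> open (f ` T))"

text \<open>A purely local notion, insensitive to changes of \<open>f\<close> away from
  \<open>x\<close>: a map glued from pieces can be tested point by point, with global injectivity
  treated separately.\<close>

definition bilipschitz_at :: "('a::metric_space \<Rightarrow> 'b::metric_space) \<Rightarrow> 'a \<Rightarrow> bool" where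
  "bilipschitz_at f x \<longleftrightarrow> (\<exists>U L. bilipschitz_chart f U L \<and> x \<in> U)"

lemma bilipschitz_chartD:
  assumes "bilipschitz_chart f U L"
  shows "open U" "0 \<le> L"
    "\<And>u v. u \<in> U \<Longrightarrow> v \<in> U \<Longrightarrow> dist (f u) (f v) \<le> L * dist u v"
    "\<And>u v. u \<in> U \<Longrightarrow> v \<in> U \<Longrightarrow> dist u v \<le> L * dist (f u) (f v)"
    "\<And>T. open T \<Longrightarrow> T \<subseteq> U \<Longrightarrow> open (f ` T)"
  using assms unfolding bilipschitz_chart_def by simp_all

lemma bilipschitz_atE:
  assumes "bilipschitz_at f x"
  obtains U L where "bilipschitz_chart f U L" "x \<in> U"
  using assms unfolding bilipschitz_at_def by blast

lemma bilipschitz_atI: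
  assumes "open U" "x \<in> U" "0 \<le> L"
    "\<And>u v. u \<in> U \<Longrightarrow> v \<in> U \<Longrightarrow> dist (f u) (f v) \<le> L * dist u v"
    "\<And>u v. u \<in> U \<Longrightarrow> v \<in> U \<Longrightarrow> dist u v \<le> L * dist (f u) (f v)"
    "\<And>T. open T \<Longrightarrow> T \<subseteq> U \<Longrightarrow> open (f ` T)"
  shows "bilipschitz_at f x"
  unfolding bilipschitz_at_def bilipschitz_chart_def
  by (intro exI[of _ U] exI[of _ L] conjI ballI allI impI) (simp_all add: assms)

lemma bilipschitz_chart_continuous_on:
  assumes "bilipschitz_chart f U L"
  shows "continuous_on U f"
proof -
  have "L-lipschitz_on U f"
    by (rule lipschitz_onI) (simp_all add: bilipschitz_chartD[OF assms])
  then show ?thesis by (rule lipschitz_on_continuous_on)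
qed

lemma bilipschitz_at_cong:
  assumes f: "bilipschitz_at f x" and S: "open S" "x \<in> S" and eq: "\<And>y. y \<in> S \<Longrightarrow> g y = f y"
  shows "bilipschitz_at g x"
proof -
  obtain U L where chU: "bilipschitz_chart f U L" "x \<in> U"
    using f by (rule bilipschitz_atE)
  note U = bilipschitz_chartD(1)[OF chU(1)] chU(2) bilipschitz_chartD(2-5)[OF chU(1)]
  have "open (g ` T)" if "open T" "T \<subseteq> U \<inter> S" for T
  proof -
    have "g ` T = f ` T" using that eq by (intro image_cong) auto
    then show ?thesis using U(6) that by auto
  qed
  then show ?thesis
    by (intro bilipschitz_atI[where U = "U \<inter> S" and L = L]) (auto simp: eq intro: U S)
qed

lemma bilipschitz_at_id: "bilipschitz_at (\<lambda>x. x) x"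
  by (rule bilipschitz_atI[of UNIV _ 1]) auto

lemma bilipschitz_at_isCont:
  assumes "bilipschitz_at f x"
  shows "isCont f x"
proof -
  obtain U L where chU: "bilipschitz_chart f U L" "x \<in> U"
    using assms by (rule bilipschitz_atE)
  note U = bilipschitz_chartD(1)[OF chU(1)] chU(2) bilipschitz_chartD(2-5)[OF chU(1)]
  have "continuous_on U f" using chU(1) by (rule bilipschitz_chart_continuous_on)
  then show ?thesis using U continuous_on_eq_continuous_at by blast
qed

lemma bilipschitz_at_continuous_on:
  assumes "\<And>x. x \<in> S \<Longrightarrow> bilipschitz_at f x"
  shows "continuous_on S f"
  using assms bilipschitz_at_isCont continuous_at_imp_continuous_on by blast

lemma bilipschitz_at_open_image:
  assumes "open S" "\<And>x. x \<in> S \<Longrightarrow> bilipschitz_at f x"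
  shows "open (f ` S)"
proof (rule topological_space_class.openI)
  fix y assume "y \<in> f ` S"
  then obtain x where x: "x \<in> S" "y = f x" by blast
  obtain U L where chU: "bilipschitz_chart f U L" "x \<in> U"
    using assms(2)[OF x(1)] by (rule bilipschitz_atE)
  note U = bilipschitz_chartD(1)[OF chU(1)] chU(2) bilipschitz_chartD(2-5)[OF chU(1)]
  have "open (f ` (U \<inter> S))" using U(1) assms(1) by (intro U(6)) auto
  then show "\<exists>T. open T \<and> y \<in> T \<and> T \<subseteq> f ` S" using x U by (intro exI[of _ "f ` (U \<inter> S)"]) auto
qed

lemma bilipschitz_at_compose:
  assumes f: "bilipschitz_at f x" and g: "bilipschitz_at g (f x)"
  shows "bilipschitz_at (\<lambda>x. g (f x)) x"
proof -
  obtain U L where chU: "bilipschitz_chart f U L" "x \<in> U"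
    using f by (rule bilipschitz_atE)
  note U = bilipschitz_chartD(1)[OF chU(1)] chU(2) bilipschitz_chartD(2-5)[OF chU(1)]
  obtain W M where chW: "bilipschitz_chart g W M" "f x \<in> W"
    using g by (rule bilipschitz_atE)
  note W = bilipschitz_chartD(1)[OF chW(1)] chW(2) bilipschitz_chartD(2-5)[OF chW(1)]
  have "open (f -` W \<inter> U)"
    using continuous_on_open_vimage[OF U(1)] bilipschitz_chart_continuous_on[OF chU(1)] W(1) by blast
  then show ?thesis
  proof (rule bilipschitz_atI[where L = "M * L"])
    fix u v assume uv: "u \<in> f -` W \<inter> U" "v \<in> f -` W \<inter> U"
    have "dist (g (f u)) (g (f v)) \<le> M * dist (f u) (f v)" using uv W by auto
    also have "\<dots> \<le> M * (L * dist u v)" using uv U W by (intro mult_left_mono) auto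
    finally show "dist (g (f u)) (g (f v)) \<le> M * L * dist u v" by (simp add: mult.assoc)
    have "dist u v \<le> L * dist (f u) (f v)" using uv U by auto
    also have "\<dots> \<le> L * (M * dist (g (f u)) (g (f v)))" using uv U W by (intro mult_left_mono) auto
    finally show "dist u v \<le> M * L * dist (g (f u)) (g (f v))" by (simp add: mult_ac)
  next
    fix T assume T: "open T" "T \<subseteq> f -` W \<inter> U"
    then have "open (g ` (f ` T))" by (intro W(6) U(6)) auto
    then show "open ((\<lambda>x. g (f x)) ` T)" by (simp add: image_image)
  qed (use U W in auto)
qed

lemma bilipschitz_at_inv_into:
  assumes f: "bilipschitz_at f x" and S: "open S" "x \<in> S" "inj_on f S"
  shows "bilipschitz_at (inv_into S f) (f x)"
proof -
  obtain U L where chU: "bilipschitz_chart f U L" "x \<in> U"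
    using f by (rule bilipschitz_atE)
  note U = bilipschitz_chartD(1)[OF chU(1)] chU(2) bilipschitz_chartD(2-5)[OF chU(1)]
  have cont: "continuous_on U f" using chU(1) by (rule bilipschitz_chart_continuous_on)
  show ?thesis
  proof (rule bilipschitz_atI[where U = "f ` (U \<inter> S)" and L = L])
    show "open (f ` (U \<inter> S))" using U(1) S(1) by (intro U(6)) auto
    show "f x \<in> f ` (U \<inter> S)" using U S by auto
    show "0 \<le> L" by fact
  next
    fix u v assume "u \<in> f ` (U \<inter> S)" "v \<in> f ` (U \<inter> S)"
    then show "dist (inv_into S f u) (inv_into S f v) \<le> L * dist u v"
      "dist u v \<le> L * dist (inv_into S f u) (inv_into S f v)"
      using U S by (auto simp: inv_into_f_f)
  next
    fix T assume T: "open T" "T \<subseteq> f ` (U \<inter> S)"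
    \<comment> \<open>An image under the inverse is a preimage under \<open>f\<close>, so its
      openness is continuity of \<open>f\<close> on the chart.\<close>
    have "inv_into S f ` T = f -` T \<inter> (U \<inter> S)"
    proof (intro equalityI subsetI)
      fix y assume "y \<in> inv_into S f ` T"
      then obtain z where "z \<in> U \<inter> S" "f z \<in> T" "y = inv_into S f (f z)" using T(2) by auto
      then show "y \<in> f -` T \<inter> (U \<inter> S)" using S(3) by (auto simp: inv_into_f_f)
    next
      fix y assume y: "y \<in> f -` T \<inter> (U \<inter> S)"
      then have "y = inv_into S f (f y)" using S(3) by (auto simp: inv_into_f_f)
      then show "y \<in> inv_into S f ` T" using y by blast
    qed
    moreover have "open (f -` T \<inter> (U \<inter> S))"
      using cont T(1) U(1) S(1) continuous_on_open_vimage[of "U \<inter> S" f]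
      by (auto intro: continuous_on_subset)
    ultimately show "open (inv_into S f ` T)" by simp
  qed
qed

text \<open>Cut a Lipschitz neighbourhood of \<open>x\<close> down to the preimage of one for the
  inverse at \<open>f x\<close>; the larger of the two constants serves both directions. Openness is
  a hypothesis because it has two sources: an open map, or a bijection with continuous
  inverse.\<close>

lemma lipschitz_embedding_bilipschitz_at:
  assumes emb: "lipschitz_embedding S T f" and S: "open S" "x \<in> S"
    and opn: "\<And>U. open U \<Longrightarrow> U \<subseteq> S \<Longrightarrow> open (f ` U)"
  shows "bilipschitz_at f x"
proof -
  have inj: "inj_on f S" and l1: "locally_lipschitz_on S f"
    and l2: "locally_lipschitz_on (f ` S) (inv_into S f)"
    using emb by (auto simp: lipschitz_embedding_def)
  obtain U L where U: "openin (top_of_set S) U" "x \<in> U" "L-lipschitz_on U f"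
    using l1 S unfolding locally_lipschitz_on_def by blast
  obtain W M where W: "openin (top_of_set (f ` S)) W" "f x \<in> W" "M-lipschitz_on W (inv_into S f)"
    using l2 S unfolding locally_lipschitz_on_def by blast
  have oU: "open U" "U \<subseteq> S" using U(1) S(1) openin_open_eq by auto
  have oW: "open W" using W(1) opn[OF S(1)] openin_open_eq by auto
  have "open (f -` W \<inter> U)"
    using continuous_on_open_vimage[OF oU(1)] lipschitz_on_continuous_on[OF U(3)] oW by blast
  then show ?thesis
  proof (rule bilipschitz_atI[where L = "max L M"])
    show "0 \<le> max L M" using lipschitz_on_nonneg[OF U(3)] by simp
    fix u v assume uv: "u \<in> f -` W \<inter> U" "v \<in> f -` W \<inter> U"
    have "dist (f u) (f v) \<le> L * dist u v" using uv U(3) by (auto dest: lipschitz_onD)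
    also have "\<dots> \<le> max L M * dist u v" by (intro mult_right_mono) auto
    finally show "dist (f u) (f v) \<le> max L M * dist u v" .
    have "dist (inv_into S f (f u)) (inv_into S f (f v)) \<le> M * dist (f u) (f v)"
      using uv W(3) by (auto dest: lipschitz_onD)
    then have "dist u v \<le> M * dist (f u) (f v)"
      using uv oU inj by (auto simp: inv_into_f_f subset_iff)
    also have "\<dots> \<le> max L M * dist (f u) (f v)" by (intro mult_right_mono) auto
    finally show "dist u v \<le> max L M * dist (f u) (f v)" .
  qed (use U W opn oU in auto)
qed

lemma open_lipschitz_embedding_bilipschitz_at:
  assumes emb: "open_lipschitz_embedding S T f" and "open S" "open T" "x \<in> S"
  shows "bilipschitz_at f x"
proof (rule lipschitz_embedding_bilipschitz_at)
  show "lipschitz_embedding S T f" using emb by (simp add: open_lipschitz_embedding_def)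
  fix U assume "open U" "U \<subseteq> S"
  then have "openin (top_of_set S) U" using \<open>open S\<close> by (simp add: openin_open_eq)
  then have "openin (top_of_set T) (f ` U)"
    using emb by (simp add: open_lipschitz_embedding_def open_map_def)
  then show "open (f ` U)" using \<open>open T\<close> openin_open_eq by auto
qed fact+

text \<open>An isomorphism is not declared to be open. Its inverse is locally Lipschitz on the open
  set \<open>T\<close>, hence continuous, and images under \<open>f\<close> are preimages under the
  inverse.\<close>

lemma lipschitz_isomorphism_bilipschitz_at:
  assumes iso: "lipschitz_isomorphism S T f" and "open S" "open T" "x \<in> S"
  shows "bilipschitz_at f x"
proof (rule lipschitz_embedding_bilipschitz_at)
  show emb: "lipschitz_embedding S T f" using iso by (simp add: lipschitz_isomorphism_def)
  have bij: "bij_betw f S T" using iso by (simp add: lipschitz_isomorphism_def)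
  have fS: "f ` S = T" using bij by (simp add: bij_betw_def)
  have "continuous_on T (inv_into S f)"
  proof (rule continuous_at_imp_continuous_on, rule ballI)
    fix y assume "y \<in> T"
    moreover have "locally_lipschitz_on T (inv_into S f)"
      using emb by (simp add: lipschitz_embedding_def fS)
    ultimately obtain W M
      where W: "openin (top_of_set T) W" "y \<in> W" "M-lipschitz_on W (inv_into S f)"
      unfolding locally_lipschitz_on_def by blast
    then have "open W" using \<open>open T\<close> openin_open_eq by auto
    then show "isCont (inv_into S f) y"
      using W(2) lipschitz_on_continuous_on[OF W(3)] continuous_on_eq_continuous_at by blast
  qed
  fix U assume U: "open U" "U \<subseteq> S"
  then have "open (inv_into S f -` U \<inter> T)"
    using \<open>continuous_on T _\<close> continuous_on_open_vimage[OF \<open>open T\<close>] by blast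
  moreover have "inv_into S f -` U \<inter> T = f ` U"
  proof (intro equalityI subsetI)
    fix y assume y: "y \<in> inv_into S f -` U \<inter> T"
    then have "f (inv_into S f y) = y" using bij_betw_inv_into_right[OF bij] by blast
    then show "y \<in> f ` U" using y by force
  next
    fix y assume "y \<in> f ` U"
    then obtain z where z: "z \<in> U" "y = f z" by blast
    then have "inv_into S f y = z" using U(2) bij_betw_inv_into_left[OF bij] by blast
    then show "y \<in> inv_into S f -` U \<inter> T" using z U(2) fS by blast
  qed
  ultimately show "open (f ` U)" by simp
qed fact+

text \<open>The way back from charts: injectivity is the only global ingredient, and the lower
  estimate of a chart says that the inverse is Lipschitz on its image.\<close>

lemma open_lipschitz_embeddingI:
  assumes S: "open S" and T: "f ` S \<subseteq> T" and inj: "inj_on f S"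
    and loc: "\<And>x. x \<in> S \<Longrightarrow> bilipschitz_at f x"
  shows "open_lipschitz_embedding S T f"
proof -
  have "\<exists>U L. openin (top_of_set S) U \<and> x \<in> U \<and> L-lipschitz_on U f"
    "\<exists>W L. openin (top_of_set (f ` S)) W \<and> f x \<in> W \<and> L-lipschitz_on W (inv_into S f)"
    if "x \<in> S" for x
  proof -
    obtain U L where chU: "bilipschitz_chart f U L" "x \<in> U"
      using loc[OF \<open>x \<in> S\<close>] by (rule bilipschitz_atE)
    note U = bilipschitz_chartD(1)[OF chU(1)] chU(2) bilipschitz_chartD(2-5)[OF chU(1)]
    have "L-lipschitz_on (U \<inter> S) f" using U(3,4) by (intro lipschitz_onI) simp_all
    moreover have "openin (top_of_set S) (U \<inter> S)" using U(1) S by (simp add: openin_open_eq open_Int)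
    moreover have "x \<in> U \<inter> S" using U(2) that by (rule IntI)
    ultimately show "\<exists>U L. openin (top_of_set S) U \<and> x \<in> U \<and> L-lipschitz_on U f"
      by (intro exI conjI)
    have "dist (inv_into S f y) (inv_into S f z) \<le> L * dist y z"
      if yz: "y \<in> f ` (U \<inter> S)" "z \<in> f ` (U \<inter> S)" for y z
    proof -
      obtain u v where "y = f u" "z = f v" "u \<in> U" "v \<in> U" "u \<in> S" "v \<in> S" using yz by blast
      then show ?thesis using U(5)[of u v] inj by simp
    qed
    then have "L-lipschitz_on (f ` (U \<inter> S)) (inv_into S f)"
      using U(3) by (rule lipschitz_onI)
    moreover have "open (f ` (U \<inter> S))" using U(1) S by (intro U(6)) auto
    then have "openin (top_of_set (f ` S)) (f ` (U \<inter> S))"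
      by (rule open_subset[OF image_mono[OF Int_lower2]])
    moreover have "f x \<in> f ` (U \<inter> S)" using \<open>x \<in> U \<inter> S\<close> by (rule imageI)
    ultimately show "\<exists>W L. openin (top_of_set (f ` S)) W \<and> f x \<in> W \<and> L-lipschitz_on W (inv_into S f)"
      by (intro exI conjI)
  qed
  note lip = this
  have "open_map (top_of_set S) (top_of_set T) f"
    unfolding open_map_def
  proof (intro allI impI)
    fix U assume "openin (top_of_set S) U"
    then have "open U" "U \<subseteq> S" using S by (auto simp: openin_open_eq)
    then have "open (f ` U)" using loc by (intro bilipschitz_at_open_image) auto
    then show "openin (top_of_set T) (f ` U)"
      using image_mono[OF \<open>U \<subseteq> S\<close>, of f] T by (intro open_subset) blast+
  qed
  moreover have "locally_lipschitz_on S f"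
    unfolding locally_lipschitz_on_def using lip(1) by (rule ballI)
  moreover have "locally_lipschitz_on (f ` S) (inv_into S f)"
    unfolding locally_lipschitz_on_def ball_simps using lip(2) by (rule ballI)
  ultimately show ?thesis
    using T inj unfolding open_lipschitz_embedding_def lipschitz_embedding_def by blast
qed

lemma lipschitz_isomorphismI:
  assumes "bij f" "\<And>x. bilipschitz_at f x"
  shows "lipschitz_isomorphism UNIV UNIV f"
proof -
  have "open_lipschitz_embedding UNIV UNIV f"
    by (rule open_lipschitz_embeddingI) (simp_all add: assms bij_is_inj)
  then show ?thesis
    using assms(1) by (simp add: lipschitz_isomorphism_def open_lipschitz_embedding_def)
qed

subsection \<open>Topological preliminaries\<close>

text \<open>The compact sets given by \<open>lc\<close> may leave \<open>W\<close>, so each is cut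
  with a closed ball inside \<open>W\<close>. Finitely many of the resulting neighbourhoods cover
  \<open>K\<close>.\<close>

lemma locally_compact_neighbourhood:
  fixes K :: "'a::metric_space set"
  assumes lc: "\<And>x::'a. \<exists>U V. open U \<and> compact V \<and> x \<in> U \<and> U \<subseteq> V"
    and K: "compact K" "open W" "K \<subseteq> W"
  obtains U V where "open U" "compact V" "K \<subseteq> U" "U \<subseteq> V" "V \<subseteq> W"
proof -
  have "\<exists>U V. open U \<and> compact V \<and> x \<in> U \<and> U \<subseteq> V \<and> V \<subseteq> W" if x: "x \<in> W" for x
  proof -
    obtain U V where UV: "open U" "compact V" "x \<in> U" "U \<subseteq> V"
      using lc[of x] by (elim exE conjE)
    obtain e where e: "e > 0" "cball x e \<subseteq> W"
      using bspec[OF K(2)[unfolded open_contains_cball] x] by (elim exE conjE)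
    have "U \<inter> ball x e \<subseteq> V \<inter> cball x e" using UV(4) ball_subset_cball by (rule Int_mono)
    moreover have "V \<inter> cball x e \<subseteq> W" using e(2) by (rule le_infI2)
    moreover have "open (U \<inter> ball x e)" using UV(1) by (simp add: open_Int)
    moreover have "compact (V \<inter> cball x e)" using UV(2) by (simp add: compact_Int_closed)
    ultimately show ?thesis
      using UV(3) e(1) by (intro exI[of _ "U \<inter> ball x e"] exI[of _ "V \<inter> cball x e"]) simp
  qed
  note nbhd = this
  define \<U> where "\<U> = {U. open U \<and> (\<exists>V. compact V \<and> U \<subseteq> V \<and> V \<subseteq> W)}"
  have "K \<subseteq> \<Union>\<U>"
  proof
    fix x assume "x \<in> K"
    then have "x \<in> W" using K(3) by blast
    from nbhd[OF this] show "x \<in> \<Union>\<U>" unfolding \<U>_def by blast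
  qed
  moreover have "\<And>B. B \<in> \<U> \<Longrightarrow> open B" by (simp add: \<U>_def)
  ultimately obtain \<D> where \<D>: "\<D> \<subseteq> \<U>" "finite \<D>" "K \<subseteq> \<Union>\<D>"
    by (rule compactE[OF K(1)])
  have "\<exists>V. compact V \<and> \<Union>\<D> \<subseteq> V \<and> V \<subseteq> W"
    using \<D>(2,1)
  proof (induction rule: finite_induct)
    case empty
    show ?case by (rule exI[of _ "{}"]) simp
  next
    case (insert A \<F>)
    obtain V where V: "compact V" "\<Union>\<F> \<subseteq> V" "V \<subseteq> W"
      using insert by auto
    obtain V' where V': "compact V'" "A \<subseteq> V'" "V' \<subseteq> W"
      using insert.prems by (auto simp: \<U>_def)
    show ?case
      using V V' by (intro exI[of _ "V \<union> V'"]) (auto intro: compact_Un)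
  qed
  then obtain V where V: "compact V" "\<Union>\<D> \<subseteq> V" "V \<subseteq> W" by (elim exE conjE)
  have "open (\<Union>\<D>)" using \<D>(1) by (auto simp: \<U>_def)
  then show thesis using V(1) \<D>(3) V(2,3) by (rule that)
qed

text \<open>The part of \<open>f(P)\<close> outside \<open>e(P)\<close> is open and closed, so a
  connected set joining \<open>f x\<close> to \<open>e x\<close> cannot leave it. One inclusion
  suffices because the hypotheses are symmetric in \<open>e\<close> and \<open>f\<close>.\<close>

lemma open_embedding_same_image_le:
  fixes e f :: "'a::topological_space \<Rightarrow> 'b::topological_space"
  assumes inj: "inj e" "inj f"
    and op: "\<And>T. open T \<Longrightarrow> open (e ` T)" "\<And>T. open T \<Longrightarrow> open (f ` T)"
    and clo: "closed (e ` P)" "closed (f ` P)"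
    and Q: "open Q" "frontier P \<subseteq> Q" "\<And>x. x \<in> Q \<Longrightarrow> e x = f x"
    and P: "closed P"
    and conn: "\<And>x. x \<in> P \<Longrightarrow> \<exists>S. connected S \<and> e x \<in> S \<and> f x \<in> S"
  shows "f ` P \<subseteq> e ` P"
proof -
  have P_eq: "P = interior P \<union> frontier P" "frontier P \<subseteq> P"
    using P interior_subset[of P] by (auto simp: frontier_def)
  define A where "A = f ` P - e ` P"
  \<comment> \<open>Frontier points contribute nothing, since there \<open>f\<close> agrees with
    \<open>e\<close>. This writes \<open>A\<close> as an open set minus a closed one.\<close>
  have "A = f ` interior P - e ` P"
  proof -
    have "f x = e x" if "x \<in> frontier P" for x using Q that by auto
    then have "f ` frontier P \<subseteq> e ` P" using P_eq(2) by auto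
    then show ?thesis using P_eq(1) interior_subset[of P] unfolding A_def by blast
  qed
  then have oA: "open A" using op(2)[of "interior P"] clo(1) by (simp add: open_Diff)
  \<comment> \<open>Now a closed set minus an open one. Removing all of \<open>e(Q)\<close> is
    harmless: a point \<open>e w = f w\<close> of \<open>A\<close> would have \<open>w\<close> in
    \<open>P\<close> by injectivity of \<open>f\<close>, hence lie in \<open>e(P)\<close>.\<close>
  have "A = f ` P - (e ` interior P \<union> e ` Q)"
  proof -
    have "y \<notin> A" if y: "y \<in> e ` Q" for y
    proof
      assume "y \<in> A"
      obtain w where w: "w \<in> Q" "y = e w" using y by blast
      have "y = f w" using w Q(3) by simp
      have "w \<in> P" using \<open>y \<in> A\<close> \<open>y = f w\<close> inj(2) by (auto simp: A_def inj_image_mem_iff)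
      then show False using \<open>y \<in> A\<close> w(2) by (auto simp: A_def)
    qed
    moreover have "e ` P \<subseteq> e ` interior P \<union> e ` Q" using P_eq(1) Q(2) by blast
    ultimately show ?thesis using interior_subset[of P] unfolding A_def by blast
  qed
  then have cA: "closed A"
    using op(1)[of "interior P"] op(1)[OF Q(1)] clo(2) by (simp add: closed_Diff open_Un)
  have "A = {}"
  proof (rule ccontr)
    assume "A \<noteq> {}"
    then obtain x where x: "x \<in> P" "f x \<in> A" by (auto simp: A_def)
    obtain S where S: "connected S" "e x \<in> S" "f x \<in> S" using conn x by blast
    have "e x \<in> A"
      using connectedD[OF S(1) oA, of "- A"] cA S x by auto
    then show False using x by (auto simp: A_def)
  qed
  then show ?thesis by (auto simp: A_def)
qed

lemma open_embedding_same_image: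
  fixes e f :: "'a::topological_space \<Rightarrow> 'b::topological_space"
  assumes "inj e" "inj f"
    and "\<And>T. open T \<Longrightarrow> open (e ` T)" "\<And>T. open T \<Longrightarrow> open (f ` T)"
    and "closed (e ` P)" "closed (f ` P)"
    and "open Q" "frontier P \<subseteq> Q" "\<And>x. x \<in> Q \<Longrightarrow> e x = f x"
    and "closed P"
    and "\<And>x. x \<in> P \<Longrightarrow> \<exists>S. connected S \<and> e x \<in> S \<and> f x \<in> S"
  shows "e ` P = f ` P"
proof
  show "f ` P \<subseteq> e ` P" by (rule open_embedding_same_image_le[where Q = Q]) (use assms in auto)
  show "e ` P \<subseteq> f ` P"
  proof (rule open_embedding_same_image_le[where Q = Q])
    show "f x = e x" if "x \<in> Q" for x using assms(9)[OF that] by simp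
    show "\<exists>S. connected S \<and> f x \<in> S \<and> e x \<in> S" if "x \<in> P" for x using assms(11)[OF that] by blast
  qed (use assms in auto)
qed

text \<open>By the tube lemma, a jointly continuous family is continuous in its parameter for the
  compact-open topology; this is the preimage of a subbasic set.\<close>

lemma open_maps_compact_into:
  assumes "continuous_on UNIV (\<lambda>(t, x). f t x)" "compact K" "open W"
  shows "open {t. f t ` K \<subseteq> W}"
proof (rule topological_space_class.openI)
  fix t assume t: "t \<in> {t. f t ` K \<subseteq> W}"
  have "open ((\<lambda>(t, x). f t x) -` W)" using assms(1,3) by (rule open_vimage[rotated])
  moreover have "{t} \<times> K \<subseteq> (\<lambda>(t, x). f t x) -` W" using t by auto
  ultimately have "\<exists>X. t \<in> X \<and> open X \<and> X \<times> K \<subseteq> (\<lambda>(t, x). f t x) -` W"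
    by (rule Elementary_Topology.tube_lemma[OF assms(2)])
  then obtain X where "t \<in> X" "open X" "X \<times> K \<subseteq> (\<lambda>(t, x). f t x) -` W"
    by (elim exE conjE)
  then show "\<exists>T. open T \<and> t \<in> T \<and> T \<subseteq> {t. f t ` K \<subseteq> W}" by (intro exI[of _ X]) auto
qed

text \<open>Transfers local compactness from the target to the source. The compact neighbourhood of
  \<open>g x\<close> is taken inside the open set \<open>range g\<close>, where \<open>inv g\<close>
  is continuous and carries it back.\<close>

lemma locally_compact_open_embedding:
  fixes g :: "'a::metric_space \<Rightarrow> 'b::metric_space" and x :: 'a
  assumes lc: "locally compact (UNIV :: 'b set)"
    and g: "inj g" "\<And>x. bilipschitz_at g x"
  shows "\<exists>U V. open U \<and> compact V \<and> x \<in> U \<and> U \<subseteq> V"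
proof -
  have "open (range g)" using g(2) by (intro bilipschitz_at_open_image) auto
  then have "openin (top_of_set UNIV) (range g)" by simp
  from lc this rangeI[of g x] obtain U V
    where UV: "openin (top_of_set UNIV) U" "compact V" "g x \<in> U" "U \<subseteq> V" "V \<subseteq> range g"
    by (rule locallyE)
  have "continuous_on UNIV g" using g(2) by (rule bilipschitz_at_continuous_on)
  then have 1: "open (g -` U)" using UV(1) by (intro open_vimage) simp_all
  have "bilipschitz_at (inv g) y" if "y \<in> range g" for y
    using that bilipschitz_at_inv_into[OF g(2) open_UNIV UNIV_I g(1)] by (elim rangeE) simp
  then have "continuous_on V (inv g)" using UV(5) by (intro bilipschitz_at_continuous_on) auto
  then have 2: "compact (inv g ` V)" using UV(2) by (rule compact_continuous_image)
  have "y \<in> inv g ` V" if "g y \<in> U" for y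
    using that UV(4) g(1) by (intro image_eqI[of _ _ "g y"]) auto
  then have "g -` U \<subseteq> inv g ` V" by auto
  with 1 2 UV(3) show ?thesis by (intro exI[of _ "g -` U"] exI[of _ "inv g ` V"]) simp
qed

subsection \<open>Gluing\<close>

text \<open>The critical points are those on the boundary of \<open>Y\<close>. They lie in the
  complement of \<open>K\<close>, which is open in the whole space, and there the extended map is
  the identity.\<close>

lemma bilipschitz_at_extend_id:
  assumes Y: "open Y" and h: "lipschitz_isomorphism Y Y h"
    and K: "closed K" "K \<subseteq> Y" and id: "\<And>x. x \<in> Y \<Longrightarrow> x \<notin> K \<Longrightarrow> h x = x"
  defines "G \<equiv> \<lambda>x. if x \<in> Y then h x else x"
  shows "bij G" "bilipschitz_at G x"
proof -
  have "bij_betw G Y Y"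
  proof (rule bij_betw_cong[THEN iffD1])
    show "bij_betw h Y Y" using h by (simp add: lipschitz_isomorphism_def)
  qed (simp add: G_def)
  moreover have "bij_betw G (- Y) (- Y)"
    using bij_betw_id by (rule bij_betw_cong[THEN iffD1, rotated]) (simp add: G_def)
  ultimately have "bij_betw G (Y \<union> - Y) (Y \<union> - Y)" by (rule bij_betw_combine) simp
  then show "bij G" by simp
  show "bilipschitz_at G x"
  proof (cases "x \<in> Y")
    case True
    show ?thesis
      using lipschitz_isomorphism_bilipschitz_at[OF h Y Y True] Y True
      by (rule bilipschitz_at_cong) (simp add: G_def)
  next
    case False
    then have "x \<in> - K" using K(2) by blast
    show ?thesis
      using bilipschitz_at_id open_Compl[OF K(1)] \<open>x \<in> - K\<close>
      by (rule bilipschitz_at_cong) (simp add: G_def id)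
  qed
qed

text \<open>Three open sets cover the target, with one formula on each: the images under
  \<open>g\<close> of \<open>interior P\<close> and of \<open>Q \<union> - P\<close>, and the
  complement of \<open>g(Z)\<close>.\<close>

lemma glue_bilipschitz:
  fixes g f :: "'a::metric_space \<Rightarrow> 'b::metric_space"
  assumes g: "inj g" "\<And>x. bilipschitz_at g x"
    and f: "inj f" "\<And>x. bilipschitz_at f x"
    and G: "bij G" "\<And>x. bilipschitz_at G x"
    and P: "closed P" and Q: "open Q" "frontier P \<subseteq> Q" "\<And>x. x \<in> Q \<Longrightarrow> g (G x) = f x"
    and eq: "(\<lambda>x. g (G x)) ` P = f ` P"
    and Z: "closed (g ` Z)" "P \<subseteq> Z" "\<And>x. x \<notin> Z \<Longrightarrow> G x = x"
  shows "\<exists>F. lipschitz_isomorphism UNIV UNIV F \<and> (\<forall>x\<in>P. F (g x) = f x) \<and>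
    (\<forall>x. x \<notin> Z \<longrightarrow> F (g x) = g x)"
proof -
  define F where "F y = (if y \<in> g ` P then f (inv g y)
    else if y \<in> range g then g (G (inv g y)) else y)" for y
  have FP: "F (g x) = f x" if "x \<in> P" for x
    using that g(1) by (simp add: F_def)
  have FnP: "F (g x) = g (G x)" if "x \<notin> P" for x
    using that g(1) by (simp add: F_def inj_image_mem_iff)
  have Fout: "F y = y" if "y \<notin> range g" for y
    using that unfolding F_def by auto
  \<comment> \<open>The complement of \<open>range g\<close> need not be open. The complement of
    \<open>g(Z)\<close> is an open set containing it, on which \<open>F\<close> is still the
    identity.\<close>
  have FZ: "F y = y" if "y \<notin> g ` Z" for y
  proof (cases "y \<in> range g")
    case True
    then obtain x where x: "y = g x" by blast
    then have "x \<notin> Z" using that by blast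
    then show ?thesis using FnP[of x] Z(2,3) x by auto
  qed (rule Fout)
  have inv_g: "bilipschitz_at (inv g) (g x)" for x
    using g(2) open_UNIV UNIV_I g(1) by (rule bilipschitz_at_inv_into)
  have loc: "bilipschitz_at F (g x)" for x
  proof -
    consider "x \<in> interior P" | "x \<in> Q \<union> - P"
      using Q(2) P by (auto simp: frontier_def)
    then show ?thesis
    proof cases
      case 1
      have 1: "bilipschitz_at (\<lambda>y. f (inv g y)) (g x)"
        using inv_g f(2) by (rule bilipschitz_at_compose)
      have 2: "open (g ` interior P)"
        using open_interior g(2) by (rule bilipschitz_at_open_image)
      have 3: "F y = f (inv g y)" if "y \<in> g ` interior P" for y
        using that interior_subset[of P] by (auto simp: F_def)
      show ?thesis
        using 1 2 imageI[OF \<open>x \<in> interior P\<close>] 3 by (rule bilipschitz_at_cong)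
    next
      case 2
      have "bilipschitz_at (\<lambda>y. G (inv g y)) (g x)"
        using inv_g G(2) by (rule bilipschitz_at_compose)
      then have 1: "bilipschitz_at (\<lambda>y. g (G (inv g y))) (g x)"
        using g(2) by (rule bilipschitz_at_compose)
      have 2: "open (g ` (Q \<union> - P))"
        using open_Un[OF Q(1) open_Compl[OF P]] g(2) by (rule bilipschitz_at_open_image)
      \<comment> \<open>On \<open>Q \<inter> P\<close> the first branch of \<open>F\<close> applies,
        but the two formulas agree on \<open>Q\<close>; hence a single formula holds across the
        frontier of \<open>P\<close>.\<close>
      have 3: "F y = g (G (inv g y))" if y: "y \<in> g ` (Q \<union> - P)" for y
      proof -
        obtain z where z: "z \<in> Q \<union> - P" "y = g z" using y by blast
        have "F (g z) = g (G z)"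
        proof (cases "z \<in> P")
          case True
          then show ?thesis using z(1) FP[of z] Q(3)[of z] by simp
        qed (rule FnP)
        then show ?thesis using z(2) g(1) by simp
      qed
      show ?thesis
        using 1 2 imageI[OF \<open>x \<in> Q \<union> - P\<close>] 3 by (rule bilipschitz_at_cong)
    qed
  qed
  have "bilipschitz_at F y" for y
  proof (cases "y \<in> range g")
    case True
    then show ?thesis using loc by blast
  next
    case False
    then have "y \<in> - g ` Z" by blast
    show ?thesis
      using bilipschitz_at_id open_Compl[OF Z(1)] \<open>y \<in> - g ` Z\<close>
      by (rule bilipschitz_at_cong) (simp add: FZ)
  qed
  \<comment> \<open>\<open>g(P)\<close> goes to \<open>f(P)\<close>, the rest of
    \<open>range g\<close> to \<open>g(G(- P))\<close>, and everything else is fixed. By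
    \<open>eq\<close> and bijectivity of \<open>G\<close> the first two targets are disjoint and
    fill \<open>range g\<close>.\<close>
  moreover have "bij F"
  proof -
    have "bij_betw F (g ` P) (f ` P)"
      unfolding bij_betw_def
    proof
      show "inj_on F (g ` P)" using FP f(1) by (auto simp: inj_on_def)
      show "F ` g ` P = f ` P"
        unfolding image_image by (rule image_cong) (simp_all add: FP)
    qed
    moreover have "bij_betw F (g ` (- P)) ((\<lambda>x. g (G x)) ` (- P))"
      unfolding bij_betw_def
    proof
      show "inj_on F (g ` (- P))"
        using FnP by (auto simp: inj_on_def inj_eq[OF g(1)] inj_eq[OF bij_is_inj[OF G(1)]])
      show "F ` g ` (- P) = (\<lambda>x. g (G x)) ` (- P)"
        unfolding image_image by (rule image_cong) (simp_all add: FnP)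
    qed
    moreover have inj: "inj (\<lambda>x. g (G x))"
      using inj_compose[OF g(1) bij_is_inj[OF G(1)]] by (simp add: comp_def)
    then have "f ` P \<inter> (\<lambda>x. g (G x)) ` (- P) = {}"
      unfolding eq[symmetric] by (auto dest: injD)
    ultimately have "bij_betw F (g ` P \<union> g ` (- P)) (f ` P \<union> (\<lambda>x. g (G x)) ` (- P))"
      by (rule bij_betw_combine)
    moreover have "f ` P \<union> (\<lambda>x. g (G x)) ` (- P) = range g"
    proof -
      have "f ` P \<union> (\<lambda>x. g (G x)) ` (- P) = (\<lambda>x. g (G x)) ` (P \<union> - P)"
        unfolding eq[symmetric] by (rule image_Un[symmetric])
      also have "\<dots> = g ` range G" by (simp add: image_image)
      finally show ?thesis using bij_is_surj[OF G(1)] by simp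
    qed
    moreover have "g ` P \<union> g ` (- P) = range g" by (simp add: image_Un[symmetric])
    ultimately have "bij_betw F (range g) (range g)" by simp
    moreover have "bij_betw F (- range g) (- range g)"
      using bij_betw_id by (rule bij_betw_cong[THEN iffD1, rotated]) (simp add: Fout)
    ultimately have "bij_betw F (range g \<union> - range g) (range g \<union> - range g)"
      by (rule bij_betw_combine) simp
    then show ?thesis by simp
  qed
  ultimately have "lipschitz_isomorphism UNIV UNIV F" by (intro lipschitz_isomorphismI)
  moreover have "F (g x) = g x" if "x \<notin> Z" for x
    using that g(1) by (intro FZ) (simp add: inj_image_mem_iff)
  ultimately show ?thesis using FP by blast
qed

subsection \<open>The compact-open topology\<close>

text \<open>Singletons are compact, so the preimage of an open set under evaluation is
  subbasic.\<close>

lemma continuous_map_compact_open_eval: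
  assumes "x \<in> topspace X"
  shows "continuous_map (compact_open_topology X Y) Y (\<lambda>f. f x)"
proof (subst continuous_map_def, unfold topspace_compact_open_topology, intro conjI allI impI)
  show "(\<lambda>f. f x) \<in> {f \<in> extensional (topspace X). continuous_map X Y f} \<rightarrow> topspace Y"
    using assms by (auto simp: continuous_map_def)
next
  fix W assume W: "openin Y W"
  have "{f \<in> extensional (topspace X). continuous_map X Y f \<and> f ` {x} \<subseteq> W} \<in>
     {{f \<in> extensional (topspace X). continuous_map X Y f \<and> f ` K \<subseteq> W} | K W.
          compactin X K \<and> openin Y W}"
    using W assms by (intro CollectI exI[of _ "{x}"] exI[of _ W]) simp
  then have "openin (compact_open_topology X Y)
    {f \<in> extensional (topspace X). continuous_map X Y f \<and> f ` {x} \<subseteq> W}"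
    unfolding compact_open_topology_def by (rule topology_generated_by_Basis)
  then show "openin (compact_open_topology X Y)
    {f \<in> {f \<in> extensional (topspace X). continuous_map X Y f}. f x \<in> W}"
    by (simp add: conj_assoc)
qed

lemma continuous_map_into_compact_open:
  assumes ext: "\<And>t. t \<in> topspace T \<Longrightarrow> h t \<in> extensional (topspace X) \<and> continuous_map X Y (h t)"
    and op: "\<And>K W. compactin X K \<Longrightarrow> openin Y W \<Longrightarrow> openin T {t \<in> topspace T. h t ` K \<subseteq> W}"
  shows "continuous_map T (compact_open_topology X Y) h"
proof -
  have "h ` topspace T \<subseteq> topspace (compact_open_topology X Y)"
    unfolding topspace_compact_open_topology using ext by blast
  moreover have "openin T (h -` U \<inter> topspace T)"
    if U: "U \<in> {{f \<in> extensional (topspace X). continuous_map X Y f \<and> f ` K \<subseteq> W} | K W.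
          compactin X K \<and> openin Y W}" for U
  proof -
    obtain K W where KW: "compactin X K" "openin Y W"
      "U = {f \<in> extensional (topspace X). continuous_map X Y f \<and> f ` K \<subseteq> W}"
      using U by blast
    have "h -` U \<inter> topspace T = {t \<in> topspace T. h t ` K \<subseteq> W}"
      unfolding KW(3) using ext by auto
    then show ?thesis using op[OF KW(1,2)] by simp
  qed
  ultimately show ?thesis
    unfolding compact_open_topology_def continuous_on_generated_topo_iff
      topology_generated_by_topspace by blast
qed

subsection \<open>Extension of the family\<close>

theorem theorem1:
  fixes f :: "'b::metric_space \<Rightarrow> 'v::metric_space \<Rightarrow> 'x::metric_space"
    and C :: "'v set"
  assumes "locally connected (UNIV :: 'b set)"
    and "locally compact (UNIV :: 'x set)"
    and "locally connected (UNIV :: 'x set)"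
    and "\<And>t. open_lipschitz_embedding UNIV UNIV (f t)"
    and "continuous_on UNIV (\<lambda>(t, x). f t x)"
    and "closed C"
    and "compact (frontier C)"
    and "\<And>t. closed (f t ` C)"
    and "lipschitz_deformable (UNIV - C)"
  shows "\<forall>b. \<exists>N F.
           b \<in> interior N \<and>
           (\<forall>t\<in>N. lipschitz_isomorphism UNIV UNIV (F t) \<and>
              (\<exists>W. C \<subseteq> interior W \<and> (\<forall>x\<in>W. F t (f b x) = f t x))) \<and>
           (compact C \<longrightarrow>
              (\<exists>K. compact K \<and> C \<subseteq> interior K \<and>
                 (\<forall>t\<in>N. \<forall>x\<in>UNIV - K. F t (f b x) = f b x)))"
proof
  fix b
  have inj_f: "inj (f t)" for t
    using assms(4)[of t] by (simp add: open_lipschitz_embedding_def lipschitz_embedding_def)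
  have bil_f: "bilipschitz_at (f t) x" for t x
    using assms(4) open_UNIV open_UNIV UNIV_I by (rule open_lipschitz_embedding_bilipschitz_at)
  have cont_f: "continuous_on S (f t)" for S t
    using bil_f by (rule bilipschitz_at_continuous_on)
  have cont_ft: "continuous_on S (\<lambda>t. f t x)" for S x
  proof -
    have "continuous_on S (\<lambda>t. (\<lambda>(t, x). f t x) (t, x))"
      by (rule continuous_on_compose2[OF assms(5)]) (auto intro: continuous_intros)
    then show ?thesis by simp
  qed
  have open_f: "open (f t ` T)" if "open T" for t T
    using that bil_f by (rule bilipschitz_at_open_image)
  define g where "g = f b"
  have inv_g: "inv g (g x) = x" for x using inj_f by (simp add: g_def)
  have lc: "\<exists>U V. open U \<and> compact V \<and> x \<in> U \<and> U \<subseteq> V" for x :: 'v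
    using assms(2) inj_f bil_f by (rule locally_compact_open_embedding)
  define Y where "Y = UNIV - C"
  have Y: "open Y" using assms(6) by (simp add: Y_def open_Diff)

  \<comment> \<open>Nested neighbourhoods of the two frontiers\<close>
  obtain O1 A where A: "open O1" "compact A" "frontier C \<subseteq> O1" "O1 \<subseteq> A" "A \<subseteq> UNIV"
    by (rule locally_compact_neighbourhood[OF lc assms(7) open_UNIV subset_UNIV])
  \<comment> \<open>Passing from \<open>C\<close> to \<open>P\<close> puts the frontier inside
    \<open>Y\<close>, where the deformation property acts, and makes an identity on \<open>P\<close>
    hold near \<open>C\<close>.\<close>
  define P where "P = C \<union> A"
  have P: "closed P" using assms(6) A(2) by (simp add: P_def closed_Un compact_imp_closed)
  have CP: "C \<subseteq> interior P"
  proof -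
    have "interior C \<subseteq> interior P" by (rule interior_mono) (simp add: P_def)
    moreover have "O1 \<subseteq> interior P" using A(1,4) by (intro interior_maximal) (auto simp: P_def)
    moreover have "C \<subseteq> interior C \<union> frontier C"
      using closure_subset[of C] by (auto simp: frontier_def)
    ultimately show ?thesis using A(3) by blast
  qed
  have frP: "frontier P = P - interior P" using P by (simp add: frontier_def)
  then have "frontier P \<subseteq> A" "frontier P \<subseteq> Y" using CP by (auto simp: P_def Y_def)
  then have "compact (frontier P)"
    using compact_Int_closed[OF A(2) frontier_closed[of P]] by (simp add: Int_absorb1)
  \<comment> \<open>The chain is \<open>frontier P \<subseteq> Q \<subseteq> D \<subseteq> U
    \<subseteq> K \<subseteq> Y\<close> with \<open>Q\<close>, \<open>U\<close> open and
    \<open>D\<close>, \<open>K\<close> compact. The deformation prescribes values on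
    \<open>D\<close>, hence on the open \<open>Q\<close>, and moves nothing off \<open>U\<close>;
    the closed set \<open>K\<close> allows extension by the identity over \<open>C\<close>.\<close>
  then obtain Q D where Q: "open Q" "compact D" "frontier P \<subseteq> Q" "Q \<subseteq> D" "D \<subseteq> Y"
    using \<open>frontier P \<subseteq> Y\<close> by (rule locally_compact_neighbourhood[OF lc _ Y])
  obtain U K where U: "open U" "compact K" "D \<subseteq> U" "U \<subseteq> K" "K \<subseteq> Y"
    using Q(2,5) by (rule locally_compact_neighbourhood[OF lc _ Y])
  have UY: "U \<subseteq> Y" using U(4,5) by (rule subset_trans)
  let ?CO = "compact_open_topology (top_of_set U) (top_of_set Y)"
  have "lipschitz_deformation Y D U"
    using assms(9) Y U(1,3) Q(2) UY
    by (simp add: lipschitz_deformable_def Y_def[symmetric] openin_open_eq)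
  then obtain N \<Phi> where N: "openin ?CO N" "restrict id U \<in> N"
    and \<Phi>: "\<forall>h\<in>N. open_lipschitz_embedding U Y h \<longrightarrow>
           lipschitz_isomorphism Y Y (\<Phi> h) \<and> (\<forall>x\<in>D. \<Phi> h x = h x) \<and> (\<forall>x\<in>Y - U. \<Phi> h x = x)"
    and \<Phi>_cont: "continuous_map (subtopology ?CO {h \<in> N. open_lipschitz_embedding U Y h})
      (compact_open_topology (top_of_set Y) (top_of_set Y)) \<Phi>"
    and \<Phi>_id: "\<Phi> (restrict id U) = restrict id Y"
    unfolding lipschitz_deformation_def by (elim exE conjE)

  \<comment> \<open>The transported embeddings into the complement of C\<close>
  define T where "T = {t. f t ` K \<subseteq> g ` Y}"
  have "open (g ` Y)" using open_f[OF Y] by (simp add: g_def)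
  \<comment> \<open>Openness rests on the compactness of \<open>K\<close>; containing
    \<open>U\<close>, it controls \<open>f t\<close> on all of \<open>U\<close>.\<close>
  then have T: "open T" unfolding T_def by (rule open_maps_compact_into[OF assms(5) U(2)])
  have bT: "b \<in> T" using U(5) by (auto simp: T_def g_def)
  have fK: "g (inv g (f t x)) = f t x" "inv g (f t x) \<in> Y" if tx: "t \<in> T" "x \<in> K" for t x
  proof -
    obtain y where "y \<in> Y" "f t x = g y" using tx by (auto simp: T_def)
    then show "g (inv g (f t x)) = f t x" "inv g (f t x) \<in> Y" by (simp_all add: inv_g)
  qed
  \<comment> \<open>The restriction makes \<open>h t\<close> a point of the compact-open space, and
    makes \<open>h b\<close> literally the inclusion \<open>restrict id U\<close>.\<close>
  define h where "h t = restrict (\<lambda>x. inv g (f t x)) U" for t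
  have h_emb: "open_lipschitz_embedding U Y (h t)" if t: "t \<in> T" for t
  proof (rule open_lipschitz_embeddingI[OF U(1)])
    show "h t ` U \<subseteq> Y" using fK(2)[OF t] U(4) by (auto simp: h_def)
    show "inj_on (h t) U"
    proof (rule inj_onI)
      fix x y assume xy: "x \<in> U" "y \<in> U" "h t x = h t y"
      then have "g (inv g (f t x)) = g (inv g (f t y))" by (simp add: h_def)
      then have "f t x = f t y" using fK(1)[OF t] xy U(4) by (auto simp: subset_iff)
      then show "x = y" using inj_f by (rule injD[rotated])
    qed
    fix x assume x: "x \<in> U"
    then obtain y where y: "f t x = g y" using fK(1)[OF t, of x] U(4) by (metis subsetD)
    have "bilipschitz_at (inv g) (g y)"
      using bilipschitz_at_inv_into[OF bil_f open_UNIV UNIV_I inj_f] by (simp add: g_def)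
    then have "bilipschitz_at (\<lambda>x. inv g (f t x)) x"
      unfolding y[symmetric] by (rule bilipschitz_at_compose[OF bil_f])
    then show "bilipschitz_at (h t) x"
      using U(1) x by (rule bilipschitz_at_cong) (simp add: h_def)
  qed
  have h_cont: "continuous_map (top_of_set T) ?CO h"
  proof (rule continuous_map_into_compact_open)
    fix t assume "t \<in> topspace (top_of_set T)"
    then have t: "t \<in> T" by simp
    have "h t ` U \<subseteq> Y"
      using h_emb[OF t] by (simp add: open_lipschitz_embedding_def lipschitz_embedding_def)
    moreover have "continuous_on U (h t)"
      using open_lipschitz_embedding_bilipschitz_at[OF h_emb[OF t] U(1) Y]
      by (rule bilipschitz_at_continuous_on)
    ultimately show "h t \<in> extensional (topspace (top_of_set U)) \<and>
        continuous_map (top_of_set U) (top_of_set Y) (h t)"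
      by (auto simp: h_def)
  next
    fix L W assume "compactin (top_of_set U) L" "openin (top_of_set Y) W"
    then have LW: "compact L" "L \<subseteq> U" "open W" "W \<subseteq> Y"
      using Y by (simp_all add: compactin_subtopology openin_open_eq)
    \<comment> \<open>Applying \<open>g\<close> turns a subbasic condition on \<open>h t\<close>
      into one on \<open>f t\<close>, where joint continuity is available.\<close>
    have "h t x \<in> W \<longleftrightarrow> f t x \<in> g ` W" if "t \<in> T" "x \<in> L" for t x
    proof -
      have "x \<in> U" "x \<in> K" using that(2) LW(2) U(4) by auto
      then show ?thesis
        using fK(1)[OF that(1) \<open>x \<in> K\<close>] inv_g by (auto simp: h_def) (metis image_eqI)
    qed
    then have "{t \<in> T. h t ` L \<subseteq> W} = T \<inter> {t. f t ` L \<subseteq> g ` W}" by blast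
    moreover have "open (g ` W)" using open_f[OF LW(3)] by (simp add: g_def)
    then have "open {t. f t ` L \<subseteq> g ` W}"
      by (rule open_maps_compact_into[OF assms(5) LW(1)])
    ultimately show "openin (top_of_set T) {t \<in> topspace (top_of_set T). h t ` L \<subseteq> W}"
      by (simp add: openin_open_Int)
  qed
  have hb: "h b = restrict id U"
    using inv_g by (auto simp: h_def g_def)
  have "openin (top_of_set T) {t \<in> T. h t \<in> N}"
    using openin_continuous_map_preimage[OF h_cont N(1)] by simp
  then have "open {t \<in> T. h t \<in> N}" using T by (simp add: openin_open_eq)
  then have "openin (top_of_set UNIV) {t \<in> T. h t \<in> N}" by simp
  moreover have "b \<in> {t \<in> T. h t \<in> N}" using bT hb N(2) by simp
  \<comment> \<open>Local connectedness of the parameter space yields a connected neighbourhood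
    \<open>S\<close> that need not be open; \<open>S\<close> is the final neighbourhood of
    \<open>b\<close>.\<close>
  ultimately obtain S0 S where S: "openin (top_of_set UNIV) S0" "connected S" "b \<in> S0" "S0 \<subseteq> S"
      "S \<subseteq> {t \<in> T. h t \<in> N}"
    by (rule locallyE[OF assms(1)])
  have bS: "b \<in> interior S" "b \<in> S" using S by (auto intro: interiorI)
  have ST: "t \<in> T" "h t \<in> N" if "t \<in> S" for t using S(5) that by auto

  \<comment> \<open>Extended isomorphisms and their dependence on the parameter\<close>
  have "continuous_map (top_of_set S) ?CO h"
    using continuous_map_from_subtopology_mono[OF h_cont] ST(1) by blast
  then have "continuous_map (top_of_set S) (subtopology ?CO {h \<in> N. open_lipschitz_embedding U Y h}) h"
    using ST h_emb by (auto simp: continuous_map_in_subtopology)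
  then have \<Phi>h_cont: "continuous_map (top_of_set S)
      (compact_open_topology (top_of_set Y) (top_of_set Y)) (\<Phi> \<circ> h)"
    using \<Phi>_cont by (rule continuous_map_compose)
  define G where "G t x = (if x \<in> Y then \<Phi> (h t) x else x)" for t x
  \<comment> \<open>This is where the rule must send the inclusion to the identity. With the
    continuity below, the points \<open>G t x\<close> for \<open>t\<close> in \<open>S\<close> form
    a connected set through \<open>x\<close>.\<close>
  have Gb: "G b x = x" for x by (simp add: G_def hb \<Phi>_id)
  have G_cont: "continuous_on S (\<lambda>t. G t x)" for x
  proof (cases "x \<in> Y")
    case True
    then have "continuous_map (compact_open_topology (top_of_set Y) (top_of_set Y)) (top_of_set Y) (\<lambda>f. f x)"
      by (intro continuous_map_compact_open_eval) simp
    with \<Phi>h_cont have "continuous_map (top_of_set S) (top_of_set Y) ((\<lambda>f. f x) \<circ> (\<Phi> \<circ> h))"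
      by (rule continuous_map_compose)
    then show ?thesis using True by (simp add: G_def comp_def)
  next
    case False
    then show ?thesis by (simp add: G_def)
  qed
  \<comment> \<open>One set, independent of \<open>t\<close>, off which every \<open>G t\<close> is
    the identity. It is \<open>C\<close> together with the compact set \<open>A \<union> K\<close>,
    so it is compact whenever \<open>C\<close> is.\<close>
  define Z where "Z = P \<union> K"

  have "\<exists>F. lipschitz_isomorphism UNIV UNIV F \<and> (\<forall>x\<in>P. F (g x) = f t x) \<and>
      (\<forall>x. x \<notin> Z \<longrightarrow> F (g x) = g x)" if t: "t \<in> S" for t
  proof -
    have iso: "lipschitz_isomorphism Y Y (\<Phi> (h t))"
      and D: "\<And>x. x \<in> D \<Longrightarrow> \<Phi> (h t) x = h t x"
      and off: "\<And>x. x \<in> Y \<Longrightarrow> x \<notin> U \<Longrightarrow> \<Phi> (h t) x = x"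
      using bspec[OF \<Phi> ST(2)[OF t]] h_emb[OF ST(1)[OF t]] by simp_all
    have offK: "\<Phi> (h t) x = x" if "x \<in> Y" "x \<notin> K" for x using off that U(4) by blast
    have G: "bij (G t)" "bilipschitz_at (G t) x" for x
      using bilipschitz_at_extend_id[OF Y iso compact_imp_closed[OF U(2)] U(5) offK]
      by (simp_all add: G_def[abs_def])
    have G_out: "G t x = x" if "x \<notin> K" for x using that offK by (simp add: G_def)
    have gG: "g (G t x) = f t x" if "x \<in> Q" for x
    proof -
      have "x \<in> D" "x \<in> U" "x \<in> K" "x \<in> Y" using that Q(4) U(3-5) by auto
      then have "G t x = inv g (f t x)" using D by (simp add: G_def h_def)
      then show ?thesis using fK(1)[OF ST(1)[OF t] \<open>x \<in> K\<close>] by simp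
    qed
    have bil_gG: "bilipschitz_at (\<lambda>x. g (G t x)) x" for x
      using G(2) bil_f unfolding g_def by (rule bilipschitz_at_compose)
    \<comment> \<open>\<open>C\<close> may be noncompact: closedness of its image is a hypothesis,
      and adding a compact image preserves it.\<close>
    have closed_g: "closed (f s ` (C \<union> L))" if "compact L" for s L
      using assms(8) compact_imp_closed[OF compact_continuous_image[OF cont_f that]]
      unfolding image_Un by (rule closed_Un)
    have eq: "(\<lambda>x. g (G t x)) ` P = f t ` P"
    proof (rule open_embedding_same_image)
      show "inj (\<lambda>x. g (G t x))"
        using inj_compose[OF inj_f[of b] bij_is_inj[OF G(1)]] by (simp add: comp_def g_def)
      show "open ((\<lambda>x. g (G t x)) ` T)" if "open T" for T
        using that bil_gG by (rule bilipschitz_at_open_image)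
      \<comment> \<open>Since \<open>K\<close> misses \<open>C\<close>, \<open>G t\<close> fixes
        \<open>C\<close> pointwise, so \<open>G t\<close> carries \<open>P\<close> to
        \<open>C\<close> together with a compact set and \<open>closed_g\<close> applies.\<close>
      have "G t ` C = C" using G_out U(5) by (auto simp: Y_def G_def)
      then have "(\<lambda>x. g (G t x)) ` P = g ` (C \<union> G t ` A)"
        unfolding P_def image_Un by (simp add: image_image[symmetric, of g "G t"] image_Un)
      moreover have "compact (G t ` A)"
        using bilipschitz_at_continuous_on[OF G(2)] A(2) by (rule compact_continuous_image)
      ultimately show "closed ((\<lambda>x. g (G t x)) ` P)" using closed_g by (simp add: g_def)
      show "closed (f t ` P)" unfolding P_def using A(2) by (rule closed_g)
      show "\<exists>S. connected S \<and> g (G t x) \<in> S \<and> f t x \<in> S" for x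
      proof (intro exI conjI)
        let ?S1 = "(\<lambda>t. g (G t x)) ` S" and ?S2 = "(\<lambda>t. f t x) ` S"
        have "continuous_on S (\<lambda>t. g (G t x))"
          unfolding g_def by (rule continuous_on_compose2[OF cont_f[of UNIV b] G_cont]) simp
        then have "connected ?S1" using S(2) by (rule connected_continuous_image)
        moreover have "connected ?S2" using cont_ft S(2) by (rule connected_continuous_image)
        moreover have "g x \<in> ?S1" using bS(2) Gb by (intro image_eqI[of _ _ b]) simp_all
        moreover have "g x \<in> ?S2" using bS(2) by (intro image_eqI[of _ _ b]) (simp_all add: g_def)
        ultimately show "connected (?S1 \<union> ?S2)" by (intro connected_Un) auto
        show "g (G t x) \<in> ?S1 \<union> ?S2" "f t x \<in> ?S1 \<union> ?S2" using t by auto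
      qed
    qed (fact inj_f open_f Q gG P)+
    show ?thesis
    proof (rule glue_bilipschitz[where G = "G t" and Q = Q])
      have "Z = C \<union> (A \<union> K)" by (auto simp: Z_def P_def)
      then show "closed (g ` Z)" using closed_g[of "A \<union> K"] A(2) U(2) by (simp add: g_def compact_Un)
      show "inj g" "bilipschitz_at g x" for x using inj_f bil_f by (simp_all add: g_def)
      show "P \<subseteq> Z" by (simp add: Z_def)
      show "G t x = x" if "x \<notin> Z" for x using that by (intro G_out) (simp add: Z_def)
    qed (fact inj_f bil_f G P Q gG eq)+
  qed
  \<comment> \<open>The conclusion asks for no continuity in \<open>t\<close>, so each
    \<open>F t\<close> may be chosen separately.\<close>
  then have "\<forall>t\<in>S. \<exists>F. lipschitz_isomorphism UNIV UNIV F \<and> (\<forall>x\<in>P. F (g x) = f t x) \<and>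
      (\<forall>x. x \<notin> Z \<longrightarrow> F (g x) = g x)" by (rule ballI)
  from bchoice[OF this] obtain F where
    F: "\<forall>t\<in>S. lipschitz_isomorphism UNIV UNIV (F t) \<and> (\<forall>x\<in>P. F t (g x) = f t x) \<and>
      (\<forall>x. x \<notin> Z \<longrightarrow> F t (g x) = g x)" by (elim exE)
  show "\<exists>N F. b \<in> interior N \<and>
           (\<forall>t\<in>N. lipschitz_isomorphism UNIV UNIV (F t) \<and>
              (\<exists>W. C \<subseteq> interior W \<and> (\<forall>x\<in>W. F t (f b x) = f t x))) \<and>
           (compact C \<longrightarrow>
              (\<exists>K. compact K \<and> C \<subseteq> interior K \<and>
                 (\<forall>t\<in>N. \<forall>x\<in>UNIV - K. F t (f b x) = f b x)))"
  proof (intro exI[of _ S] exI[of _ F] conjI ballI impI)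
    fix t assume "t \<in> S"
    \<comment> \<open>The neighbourhood \<open>W\<close> of \<open>C\<close> is \<open>P\<close>,
      for every \<open>t\<close>.\<close>
    then show "lipschitz_isomorphism UNIV UNIV (F t)"
      "\<exists>W. C \<subseteq> interior W \<and> (\<forall>x\<in>W. F t (f b x) = f t x)"
      using F CP by (auto simp: g_def)
  next
    assume "compact C"
    then have "compact Z" using A(2) U(2) by (simp add: Z_def P_def compact_Un)
    moreover have "C \<subseteq> interior Z" using CP interior_mono[of P Z] by (auto simp: Z_def)
    moreover have "\<forall>t\<in>S. \<forall>x\<in>UNIV - Z. F t (f b x) = f b x" using F by (simp add: g_def)
    ultimately show "\<exists>K. compact K \<and> C \<subseteq> interior K \<and>
        (\<forall>t\<in>S. \<forall>x\<in>UNIV - K. F t (f b x) = f b x)" by blast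
  qed (rule bS)
qed

end
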